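(* Let $z_0>0$, let $t\in\mathbb R$ be fixed, and let $$u_{\mathrm{linear}}(t,x)=\sum_{n\in\mathbb Z^\nu}c(n)\,g_n\,e^{-\mathrm itQ(n)}e^{\mathrm i\theta_n(x)},\qquad x\in\mathbb R^d,$$ be the solution of $\mathrm i\partial_tu+\Delta u=0$, $u(0,x)=\sum_{n\in\mathbb Z^\nu}c(n)g_ne^{\mathrm i\theta_n(x)}$. Then $$\lim_{\varepsilon\to0^+}\varepsilon\log\mathbb P\Big(\sup_{x\in\mathbb R^d}|u_{\mathrm{linear}}(t,x)|>z_0\,\varepsilon^{-1/2}\Big)=-\frac{z_0^2}{\sum_{n\in\mathbb Z^\nu}|c(n)|^2}.$$
   Context: Let $d\ge1$, let $\nu_1,\dots,\nu_d\ge1$ be integers and $\nu=\sum_{j=1}^d\nu_j>d$. Write $n\in\mathbb Z^\nu$ as $n=(n_1,\dots,n_d)$ with $n_j=(n_{j,1},\dots,n_{j,\nu_j})\in\mathbb Z^{\nu_j}$. For each $j$ fix a frequency vector $\omega_j\in\mathbb R^{\nu_j}$ that is rationally independent: $\langle m,\omega_j\rangle=0$ with $m\in\mathbb Z^{\nu_j}$ implies $m=0$. For $x\in\mathbb R^d$ put $\theta_n(x)=\sum_{j=1}^d\langle n_j,\omega_j\rangle x_j$, and put $Q(n)=\sum_{j=1}^d\langle n_j,\omega_j\rangle^2$. Random data: $c:\mathbb Z^\nu\to\mathbb C$ is deterministic, not identically zero, with $|c(n)|\le\prod_{j=1}^d\prod_{j'=1}^{\nu_j}(1+|n_{j,j'}|)^{-\rho_{j,j'}}$,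 where the $\rho_{j,j'}$ are large enough in the sense that there are $\kappa_{j,j'}>0$ with $\rho_{j,j'}-\kappa_{j,j'}>2$ for all $j,j'$ (i.e. all $\rho_{j,j'}>2$). On a probability space $(\Omega,\mathcal F,\mathbb P)$, $(g_n)_{n\in\mathbb Z^\nu}$ are i.i.d. standard complex Gaussian variables (real and imaginary parts independent $\mathcal N(0,\frac12)$). *)

theory Defs
  imports "HOL-Probability.Probability"
begin

text \<open>
  The space dimension is \<open>d = CARD('d)\<close>, the index \<open>j\<close> ranges over the finite type \<open>'d\<close>, and
  \<open>x\<close> is a vector of type \<open>real ^ 'd\<close>.  Since the block sizes \<open>\<nu> j\<close> depend on \<open>j\<close>, an integer
  vector of length \<open>k\<close> is an extensional function on \<open>{1..k}\<close> (so that distinct functions are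
  distinct vectors), and an element \<open>n\<close> of the full lattice is a family of such vectors, with
  entries \<open>n j k\<close>.
\<close>

definition int_vecs :: "nat \<Rightarrow> (nat \<Rightarrow> int) set" where
  "int_vecs k = {1..k} \<rightarrow>\<^sub>E UNIV"

definition freq_lattice :: "('d::finite \<Rightarrow> nat) \<Rightarrow> ('d \<Rightarrow> nat \<Rightarrow> int) set" where
  "freq_lattice \<nu> = (\<Pi>\<^sub>E j\<in>UNIV. int_vecs (\<nu> j))"

definition freq_pairing :: "nat \<Rightarrow> (nat \<Rightarrow> int) \<Rightarrow> (nat \<Rightarrow> real) \<Rightarrow> real" where
  "freq_pairing k m \<omega> = (\<Sum>i=1..k. of_int (m i) * \<omega> i)"

definition rationally_independent :: "nat \<Rightarrow> (nat \<Rightarrow> real) \<Rightarrow> bool" where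
  "rationally_independent k \<omega> \<longleftrightarrow>
     (\<forall>m\<in>int_vecs k. freq_pairing k m \<omega> = 0 \<longrightarrow> (\<forall>i\<in>{1..k}. m i = 0))"

definition theta ::
  "('d::finite \<Rightarrow> nat) \<Rightarrow> ('d \<Rightarrow> nat \<Rightarrow> real) \<Rightarrow> ('d \<Rightarrow> nat \<Rightarrow> int) \<Rightarrow> real ^ 'd \<Rightarrow> real" where
  "theta \<nu> \<omega> n x = (\<Sum>j\<in>UNIV. freq_pairing (\<nu> j) (n j) (\<omega> j) * x $ j)"

definition Q_form ::
  "('d::finite \<Rightarrow> nat) \<Rightarrow> ('d \<Rightarrow> nat \<Rightarrow> real) \<Rightarrow> ('d \<Rightarrow> nat \<Rightarrow> int) \<Rightarrow> real" where
  "Q_form \<nu> \<omega> n = (\<Sum>j\<in>UNIV. (freq_pairing (\<nu> j) (n j) (\<omega> j))\<^sup>2)"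

text \<open>
  The second argument of \<open>normal_density\<close> is the standard deviation, so both parts have
  variance \<open>1/2\<close>.
\<close>

definition std_complex_gaussian :: "'w measure \<Rightarrow> ('w \<Rightarrow> complex) \<Rightarrow> bool" where
  "std_complex_gaussian M X \<longleftrightarrow>
     distributed M lborel (\<lambda>w. Re (X w)) (normal_density 0 (sqrt (1/2))) \<and>
     distributed M lborel (\<lambda>w. Im (X w)) (normal_density 0 (sqrt (1/2))) \<and>
     prob_space.indep_var M borel (\<lambda>w. Re (X w)) borel (\<lambda>w. Im (X w))"

text \<open>
  Here \<open>g\<close> is one realisation of the Gaussian coefficients.  The series is unconditional; almost
  surely it converges absolutely, uniformly in \<open>x\<close>.
\<close>

definition u_linear ::
  "('d::finite \<Rightarrow> nat) \<Rightarrow> ('d \<Rightarrow> nat \<Rightarrow> real) \<Rightarrow> (('d \<Rightarrow> nat \<Rightarrow> int) \<Rightarrow> complex) \<Rightarrow>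
   (('d \<Rightarrow> nat \<Rightarrow> int) \<Rightarrow> complex) \<Rightarrow> real \<Rightarrow> real ^ 'd \<Rightarrow> complex" where
  "u_linear \<nu> \<omega> c g t x =
     (\<Sum>\<^sub>\<infinity>n\<in>freq_lattice \<nu>. c n * g n * exp (- \<i> * of_real (t * Q_form \<nu> \<omega> n))
                                * exp (\<i> * of_real (theta \<nu> \<omega> n x)))"

end

theory Submission
  imports Defs
begin

text \<open>
  Only two properties of the terms \<open>f n x * g n\<close> of the series matter: \<open>cmod (f n x) = s n\<close> does not
  depend on \<open>x\<close>, and \<open>s\<close> is summable.  Let \<open>V\<close> be the sum of the \<open>(s n)\<^sup>2\<close>.

  Upper bound: for \<open>\<tau> > 0\<close> put \<open>v n = s n / (s n + \<tau>)\<close>, so that \<open>((s n)\<^sup>2 + \<tau> * s n) * v n = (s n)\<^sup>2\<close>.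
  By Cauchy-Schwarz, the squared supremum over \<open>x\<close> is at most \<open>V + \<tau> * (\<Sum>n. s n)\<close> times the energy
  \<open>\<Sum>n. v n * \<bar>g n\<bar>\<^sup>2\<close>.  As \<open>v n < 1\<close> and \<open>v\<close> is summable, the energy has a finite exponential moment of
  every order \<open>a < 1\<close>, and Chernoff's inequality gives a Gaussian tail whose rate tends to \<open>1 / V\<close> as
  \<open>\<tau> \<rightarrow> 0\<close> and \<open>a \<rightarrow> 1\<close>.

  Lower bound: at a single point \<open>x\<close> the real parts of the partial sums are normal with variances
  tending to \<open>V / 2\<close>.
\<close>

section \<open>Exponential moments and tails of Gaussian variables\<close>

lemma (in prob_space) nn_integral_exp_normal_square:
  assumes X: "distributed M lborel X (normal_density 0 (sqrt (1/2)))" and b: "b < 1"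
  shows "(\<integral>\<^sup>+w. ennreal (exp (b * (X w)\<^sup>2)) \<partial>M) = ennreal (1 / sqrt (1 - b))"
proof -
  \<comment> \<open>Multiplying the density by \<open>exp (b * x\<^sup>2)\<close> keeps its Gaussian
    shape; \<open>s\<close> is the standard deviation of the normal density of which the product is
    a multiple.\<close>
  define s where "s = sqrt (1 / (2 * (1 - b)))"
  have s: "s > 0" "s\<^sup>2 = 1 / (2 * (1 - b))"
    using b by (auto simp: s_def)
  have eq: "normal_density 0 (sqrt (1/2)) x * exp (b * x\<^sup>2) = normal_density 0 s x / sqrt (1 - b)" for x
  proof -
    have "- (x\<^sup>2) + b * x\<^sup>2 = - (x\<^sup>2 / (2 * s\<^sup>2))"
      using b by (simp add: s field_simps)
    then have "exp (- (x\<^sup>2)) * exp (b * x\<^sup>2) = exp (- (x\<^sup>2 / (2 * s\<^sup>2)))"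
      by (simp only: flip: exp_add)
    moreover have "normal_density 0 (sqrt (1/2)) x = 1 / sqrt pi * exp (- (x\<^sup>2))"
      by (simp add: normal_density_def)
    moreover have "sqrt (2 * pi * s\<^sup>2) = sqrt pi / sqrt (1 - b)"
      using b by (simp add: s field_simps flip: real_sqrt_divide)
    then have "normal_density 0 s x / sqrt (1 - b) = 1 / sqrt pi * exp (- (x\<^sup>2 / (2 * s\<^sup>2)))"
      using b unfolding normal_density_def by simp
    ultimately show ?thesis by (simp add: mult.assoc)
  qed
  have "(\<integral>\<^sup>+w. ennreal (exp (b * (X w)\<^sup>2)) \<partial>M) =
      (\<integral>\<^sup>+x. ennreal (normal_density 0 (sqrt (1/2)) x) * ennreal (exp (b * x\<^sup>2)) \<partial>lborel)"
    by (rule distributed_nn_integral[OF X, symmetric]) simp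
  also have "\<dots> = (\<integral>\<^sup>+x. ennreal (1 / sqrt (1 - b)) * ennreal (normal_density 0 s x) \<partial>lborel)"
    using b by (intro nn_integral_cong) (simp add: eq flip: ennreal_mult)
  also have "\<dots> = ennreal (1 / sqrt (1 - b)) * (\<integral>\<^sup>+x. ennreal (normal_density 0 s x) \<partial>lborel)"
    by (rule nn_integral_cmult) simp
  also have "(\<integral>\<^sup>+x. ennreal (normal_density 0 s x) \<partial>lborel) = 1"
    using s(1) by (simp add: nn_integral_eq_integral normal_density_nonneg)
  finally show ?thesis by simp
qed

text \<open>The squared modulus is a sum of two independent squares, so the moment is the product of
  two equal real ones, each \<open>1 / sqrt (1 - b)\<close>.\<close>

lemma (in prob_space) nn_integral_exp_std_complex_gaussian:
  assumes X: "std_complex_gaussian M X" and b: "b < 1"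
  shows "(\<integral>\<^sup>+w. ennreal (exp (b * (cmod (X w))\<^sup>2)) \<partial>M) = ennreal (1 / (1 - b))"
proof -
  have Re: "distributed M lborel (\<lambda>w. Re (X w)) (normal_density 0 (sqrt (1/2)))"
    and Im: "distributed M lborel (\<lambda>w. Im (X w)) (normal_density 0 (sqrt (1/2)))"
    and ind: "indep_var borel (\<lambda>w. Re (X w)) borel (\<lambda>w. Im (X w))"
    using X by (auto simp: std_complex_gaussian_def)
  define Y where "Y = case_bool (\<lambda>w. Re (X w)) (\<lambda>w. Im (X w))"
  have "indep_vars (case_bool borel borel) Y UNIV"
    using ind by (simp add: indep_var_def Y_def)
  then have ind': "indep_vars (\<lambda>_. borel :: ennreal measure) (\<lambda>i w. ennreal (exp (b * (Y i w)\<^sup>2))) UNIV"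
    by (rule indep_vars_compose2[where Y = "\<lambda>_ y. ennreal (exp (b * y\<^sup>2))"]) (auto split: bool.split)
  have "(\<integral>\<^sup>+w. ennreal (exp (b * (cmod (X w))\<^sup>2)) \<partial>M) =
      (\<integral>\<^sup>+w. (\<Prod>i\<in>UNIV. ennreal (exp (b * (Y i w)\<^sup>2))) \<partial>M)"
    by (intro nn_integral_cong)
      (simp add: UNIV_bool Y_def cmod_power2 distrib_left exp_add flip: ennreal_mult)
  also have "\<dots> = (\<Prod>i\<in>UNIV. \<integral>\<^sup>+w. ennreal (exp (b * (Y i w)\<^sup>2)) \<partial>M)"
    by (rule indep_vars_nn_integral[OF _ ind']) auto
  also have "\<dots> = ennreal (1 / sqrt (1 - b)) * ennreal (1 / sqrt (1 - b))"
    using nn_integral_exp_normal_square[OF Re b] nn_integral_exp_normal_square[OF Im b]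
    by (simp add: UNIV_bool Y_def)
  also have "\<dots> = ennreal (1 / (1 - b))"
    using b by (simp flip: ennreal_mult)
  finally show ?thesis .
qed

lemma (in prob_space) normal_density_scale:
  assumes X: "distributed M lborel X (normal_density 0 \<sigma>)" and "\<sigma> > 0" "\<alpha> \<noteq> 0"
  shows "distributed M lborel (\<lambda>w. \<alpha> * X w) (normal_density 0 (\<bar>\<alpha>\<bar> * \<sigma>))"
  using normal_density_affine[OF X, of \<alpha> 0] assms by simp

text \<open>Rotation invariance of the complex Gaussian: the real part combines two independent
  normals with coefficients \<open>Re a\<close> and \<open>- Im a\<close>, whose squares add up to
  \<open>(cmod a)\<^sup>2\<close>.\<close>

lemma (in prob_space) Re_mult_std_complex_gaussian:
  assumes X: "std_complex_gaussian M X" and a: "a \<noteq> 0"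
  shows "distributed M lborel (\<lambda>w. Re (a * X w)) (normal_density 0 (cmod a / sqrt 2))"
proof -
  have Re: "distributed M lborel (\<lambda>w. Re (X w)) (normal_density 0 (sqrt (1/2)))"
    and Im: "distributed M lborel (\<lambda>w. Im (X w)) (normal_density 0 (sqrt (1/2)))"
    and ind: "indep_var borel (\<lambda>w. Re (X w)) borel (\<lambda>w. Im (X w))"
    using X by (auto simp: std_complex_gaussian_def)
  note nRe = normal_density_scale[OF Re, of "Re a"]
  note nIm = normal_density_scale[OF Im, of "- Im a"]
  \<comment> \<open>A vanishing coefficient would contribute a constant, which has no density, so
    the sum rule for normals applies in the third case only.\<close>
  consider "Im a = 0" | "Re a = 0" | "Re a \<noteq> 0" "Im a \<noteq> 0" by blast
  then show ?thesis
  proof cases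
    case 1
    with a nRe show ?thesis
      by (simp add: complex_eq_iff cmod_eq_Re real_sqrt_divide)
  next
    case 2
    with a nIm show ?thesis
      by (simp add: complex_eq_iff cmod_eq_Im real_sqrt_divide)
  next
    case 3
    have "indep_var borel ((\<lambda>x. Re a * x) \<circ> (\<lambda>w. Re (X w))) borel ((\<lambda>x. - Im a * x) \<circ> (\<lambda>w. Im (X w)))"
      by (rule indep_var_compose[OF ind]) auto
    then have "indep_var borel (\<lambda>w. Re a * Re (X w)) borel (\<lambda>w. - Im a * Im (X w))"
      by (simp add: o_def)
    from add_indep_normal[OF this _ _ nRe nIm] 3
    have "distributed M lborel (\<lambda>w. Re a * Re (X w) + - Im a * Im (X w))
      (normal_density (0 + 0) (sqrt ((\<bar>Re a\<bar> * sqrt (1/2))\<^sup>2 + (\<bar>- Im a\<bar> * sqrt (1/2))\<^sup>2)))"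
      by simp
    moreover have "sqrt ((\<bar>Re a\<bar> * sqrt (1/2))\<^sup>2 + (\<bar>- Im a\<bar> * sqrt (1/2))\<^sup>2) = cmod a / sqrt 2"
      by (simp add: power_mult_distrib cmod_def real_sqrt_divide[symmetric] add_divide_distrib del: real_sqrt_divide)
    ultimately show ?thesis by simp
  qed
qed

text \<open>The density decreases on the positive half-line, so its value at \<open>l + 1\<close>
  bounds the mass of the unit interval \<open>{l..l+1}\<close> from below. The shift by 1 disappears
  on the logarithmic scale of the final limit.\<close>

lemma (in prob_space) prob_ge_normal_density:
  assumes X: "distributed M lborel X (normal_density 0 \<sigma>)" and "\<sigma> > 0" "l \<ge> 0"
  shows "prob {w \<in> space M. l \<le> X w} \<ge> normal_density 0 \<sigma> (l + 1)"
proof -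
  have [measurable]: "X \<in> borel_measurable M"
    using distributed_measurable[OF X] by simp
  have "ennreal (normal_density 0 \<sigma> (l + 1)) =
      (\<integral>\<^sup>+x. ennreal (normal_density 0 \<sigma> (l + 1)) * indicator {l..l+1} x \<partial>lborel)"
    by (simp add: nn_integral_cmult)
  also have "\<dots> \<le> (\<integral>\<^sup>+x. ennreal (normal_density 0 \<sigma> x) * indicator {l..} x \<partial>lborel)"
  proof (intro nn_integral_mono)
    fix x :: real
    show "ennreal (normal_density 0 \<sigma> (l + 1)) * indicator {l..l+1} x
        \<le> ennreal (normal_density 0 \<sigma> x) * indicator {l..} x"
    proof (cases "x \<in> {l..l+1}")
      case True
      then have "x\<^sup>2 \<le> (l + 1)\<^sup>2"
        using \<open>l \<ge> 0\<close> by (intro power_mono) auto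
      then have "normal_density 0 \<sigma> (l + 1) \<le> normal_density 0 \<sigma> x"
        using \<open>\<sigma> > 0\<close> by (simp add: normal_density_def divide_simps)
      with True show ?thesis by (simp add: ennreal_leI)
    qed simp
  qed
  also have "\<dots> = emeasure M (X -` {l..} \<inter> space M)"
    using distributed_emeasure[OF X, of "{l..}"] by simp
  also have "X -` {l..} \<inter> space M = {w \<in> space M. l \<le> X w}" by auto
  finally show ?thesis
    by (simp add: emeasure_eq_measure)
qed

section \<open>Summability over the frequency lattice\<close>

lemma summable_on_one_plus_abs_powr:
  assumes "r > 1"
  shows "(\<lambda>m::int. (1 + \<bar>real_of_int m\<bar>) powr (- r)) summable_on UNIV"
proof -
  define h where "h = (\<lambda>m::int. (1 + \<bar>real_of_int m\<bar>) powr (- r))"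
  have "summable (\<lambda>n. real n powr (- r))"
    using assms by (simp add: summable_real_powr_iff)
  then have "summable (\<lambda>n. h (int n))"
    by (subst (asm) summable_Suc_iff[symmetric]) (simp add: h_def add.commute)
  then have nat: "(\<lambda>n. h (int n)) summable_on UNIV"
    by (intro norm_summable_imp_summable_on) (simp add: h_def)
  have "h summable_on range int"
    using nat by (subst summable_on_reindex) (auto simp: o_def)
  moreover have "h summable_on range (\<lambda>n. - int n)"
    using nat by (subst summable_on_reindex) (auto simp: o_def h_def inj_on_def)
  ultimately have "h summable_on (range int \<union> range (\<lambda>n. - int n))"
    by (rule summable_on_union)
  moreover have "range int \<union> range (\<lambda>n. - int n) = UNIV"
    by (auto intro: int_cases2)
  ultimately show ?thesis by (simp add: h_def)
qed

lemma countable_int_vecs: "countable (int_vecs k)"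
  unfolding int_vecs_def by (rule countable_PiE) auto

lemma countable_freq_lattice: "countable (freq_lattice \<nu>)"
  unfolding freq_lattice_def by (rule countable_PiE) (auto intro: countable_int_vecs)

text \<open>A sum of products over all families factors into a product of one-dimensional sums. This
  is applied twice, to the coordinates inside a block and then to the blocks.\<close>

lemma summable_on_freq_lattice_prod_powr:
  assumes "\<And>j k. k \<in> {1..\<nu> j} \<Longrightarrow> \<rho> j k > 1"
  shows "(\<lambda>n. \<Prod>j\<in>UNIV. \<Prod>k=1..\<nu> j. (1 + \<bar>real_of_int (n j k)\<bar>) powr (- \<rho> j k))
    summable_on freq_lattice \<nu>"
proof -
  have "Infinite_Set_Sum.abs_summable_on
      (\<lambda>m. \<Prod>k=1..\<nu> j. (1 + \<bar>real_of_int (m k)\<bar>) powr (- \<rho> j k)) (int_vecs (\<nu> j))" for j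
    unfolding int_vecs_def using assms
    by (intro abs_summable_on_prod_PiE)
      (auto simp flip: abs_summable_equivalent intro!: summable_on_one_plus_abs_powr)
  then have "Infinite_Set_Sum.abs_summable_on
      (\<lambda>n. \<Prod>j\<in>UNIV. \<Prod>k=1..\<nu> j. (1 + \<bar>real_of_int (n j k)\<bar>) powr (- \<rho> j k)) (freq_lattice \<nu>)"
    unfolding freq_lattice_def
    by (intro abs_summable_on_prod_PiE[of UNIV _ "\<lambda>j m. \<Prod>k=1..\<nu> j. (1 + \<bar>real_of_int (m k)\<bar>) powr (- \<rho> j k)"])
      (auto intro: countable_int_vecs)
  then show ?thesis
    by (auto simp flip: abs_summable_equivalent intro: abs_summable_summable)
qed

section \<open>Exhaustions, and infinite sums depending on a parameter\<close>

lemma exhausting_finite_subsets: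
  assumes "countable I" "I \<noteq> {}"
  obtains A :: "nat \<Rightarrow> 'i set" where "incseq A" "\<And>N. finite (A N)" "\<And>N. A N \<noteq> {}"
    "\<And>N. A N \<subseteq> I" "filterlim A (finite_subsets_at_top I) sequentially"
proof
  \<comment> \<open>Initial segments of an enumeration turn limits along finite subsets into limits
    of sequences, as continuity of the measure requires. \<open>from_nat_into\<close> stays in the
    nonempty \<open>I\<close> even when \<open>I\<close> is finite and indices are left
    over.\<close>
  define A where "A N = from_nat_into I ` {..N}" for N :: nat
  show inc: "incseq A" by (auto simp: A_def incseq_def)
  show "finite (A N)" "A N \<noteq> {}" "A N \<subseteq> I" for N
    using assms from_nat_into[OF assms(2)] by (auto simp: A_def)
  show "filterlim A (finite_subsets_at_top I) sequentially"
    unfolding filterlim_finite_subsets_at_top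
  proof (intro allI impI)
    fix F assume F: "finite F \<and> F \<subseteq> I"
    define N0 where "N0 = Max (insert 0 (to_nat_on I ` F))"
    have "F \<subseteq> A N" if "N \<ge> N0" for N
    proof
      fix x assume x: "x \<in> F"
      then have "to_nat_on I x \<le> N0"
        using F by (auto simp: N0_def intro!: Max_ge)
      moreover have "x = from_nat_into I (to_nat_on I x)"
        using x F assms by (intro from_nat_into_to_nat_on[symmetric]) auto
      ultimately show "x \<in> A N" using that by (auto simp: A_def)
    qed
    moreover have "finite (A N)" "A N \<subseteq> I" for N
      using from_nat_into[OF assms(2)] by (auto simp: A_def)
    ultimately show "\<forall>\<^sub>F N in sequentially. finite (A N) \<and> F \<subseteq> A N \<and> A N \<subseteq> I"
      by (intro eventually_sequentiallyI[of N0]) auto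
  qed
qed

text \<open>The norms do not depend on \<open>x\<close>, hence neither does absolute summability:
  either the Weierstrass test gives uniform convergence, or the sum has the default value 0 at every
  \<open>x\<close>.\<close>

lemma continuous_on_infsum_complex:
  fixes F :: "'i \<Rightarrow> 'x::topological_space \<Rightarrow> complex"
  assumes cont: "\<And>n. n \<in> I \<Longrightarrow> continuous_on UNIV (F n)"
    and bound: "\<And>n x. n \<in> I \<Longrightarrow> cmod (F n x) = b n"
  shows "continuous_on UNIV (\<lambda>x. \<Sum>\<^sub>\<infinity>n\<in>I. F n x)"
proof (cases "b summable_on I")
  case True
  show ?thesis
  proof (rule uniform_limit_theorem)
    show "uniform_limit UNIV (\<lambda>X x. \<Sum>n\<in>X. F n x) (\<lambda>x. \<Sum>\<^sub>\<infinity>n\<in>I. F n x) (finite_subsets_at_top I)"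
      using True bound by (intro Weierstrass_m_test_general) auto
    show "\<forall>\<^sub>F X in finite_subsets_at_top I. continuous_on UNIV (\<lambda>x. \<Sum>n\<in>X. F n x)"
      by (intro eventually_finite_subsets_at_top_weakI continuous_on_sum cont) auto
  qed simp
next
  case False
  have "(\<Sum>\<^sub>\<infinity>n\<in>I. F n x) = 0" for x
  proof (rule infsum_not_exists)
    have "(\<lambda>n. cmod (F n x)) summable_on I \<longleftrightarrow> b summable_on I"
      by (intro summable_on_cong bound)
    with False show "\<not> (\<lambda>n. F n x) summable_on I"
      by (simp add: summable_on_iff_abs_summable_on_complex)
  qed
  then show ?thesis by simp
qed

text \<open>The sum is a Lebesgue integral over \<open>count_space I\<close>, and integrals
  depending on a parameter are measurable. Both sides default to 0 at the same points, since complex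
  summability is absolute.\<close>

lemma borel_measurable_infsum_complex:
  fixes F :: "'i \<Rightarrow> 'w \<Rightarrow> complex"
  assumes "countable I" and F: "\<And>n. n \<in> I \<Longrightarrow> F n \<in> borel_measurable M"
  shows "(\<lambda>w. \<Sum>\<^sub>\<infinity>n\<in>I. F n w) \<in> borel_measurable M"
proof -
  interpret sigma_finite_measure "count_space I"
    by (rule sigma_finite_measure_count_space_countable) fact
  have "(\<lambda>(w, n). F n w) \<in> borel_measurable (M \<Otimes>\<^sub>M count_space I)"
    using assms measurable_pair_swap[of "\<lambda>(n, w). F n w" "count_space I" M borel]
    by (simp add: measurable_pair_measure_countable1)
  then have "(\<lambda>w. \<integral>n. F n w \<partial>count_space I) \<in> borel_measurable M"
    by (rule borel_measurable_lebesgue_integral)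
  moreover have "(\<integral>n. F n w \<partial>count_space I) = (\<Sum>\<^sub>\<infinity>n\<in>I. F n w)" for w
  proof (cases "(\<lambda>n. F n w) summable_on I")
    case True
    then have "Infinite_Set_Sum.abs_summable_on (\<lambda>n. F n w) I"
      by (simp add: summable_on_iff_abs_summable_on_complex abs_summable_equivalent)
    from infsetsum_infsum[OF this] show ?thesis by (simp add: infsetsum_def)
  next
    case False
    then have "\<not> Infinite_Set_Sum.abs_summable_on (\<lambda>n. F n w) I"
      by (simp add: summable_on_iff_abs_summable_on_complex abs_summable_equivalent)
    from not_summable_infsetsum_eq[OF this] show ?thesis
      using False by (simp add: infsetsum_def infsum_not_exists)
  qed
  ultimately show ?thesis by simp
qed

text \<open>With \<open>\<tau> = 0\<close> the first factor would be exactly the sum of the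
  \<open>(s n)\<^sup>2\<close>, but all weights would be 1 and the Gaussian energy of an infinite
  index set would diverge. A positive \<tau> buys summable weights for a small loss in the first
  factor.\<close>

lemma weighted_Cauchy_Schwarz:
  fixes s y :: "'i \<Rightarrow> real"
  assumes "\<And>n. n \<in> A \<Longrightarrow> s n > 0" "\<tau> > 0"
  shows "(\<Sum>n\<in>A. s n * y n)\<^sup>2 \<le> (\<Sum>n\<in>A. (s n)\<^sup>2 + \<tau> * s n) * (\<Sum>n\<in>A. s n / (s n + \<tau>) * (y n)\<^sup>2)"
proof -
  have "(\<Sum>n\<in>A. s n * y n) = (\<Sum>n\<in>A. sqrt ((s n)\<^sup>2 + \<tau> * s n) * (sqrt (s n / (s n + \<tau>)) * y n))"
  proof (intro sum.cong refl)
    fix n assume "n \<in> A"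
    then have n: "s n > 0" by (rule assms)
    have "((s n)\<^sup>2 + \<tau> * s n) * (s n / (s n + \<tau>)) = (s n)\<^sup>2"
      using n \<open>\<tau> > 0\<close> by (simp add: power2_eq_square field_simps)
    then have "sqrt ((s n)\<^sup>2 + \<tau> * s n) * sqrt (s n / (s n + \<tau>)) = sqrt ((s n)\<^sup>2)"
      by (simp only: flip: real_sqrt_mult)
    with n show "s n * y n = sqrt ((s n)\<^sup>2 + \<tau> * s n) * (sqrt (s n / (s n + \<tau>)) * y n)"
      by simp
  qed
  also have "\<dots>\<^sup>2 \<le> (\<Sum>n\<in>A. (sqrt ((s n)\<^sup>2 + \<tau> * s n))\<^sup>2) * (\<Sum>n\<in>A. (sqrt (s n / (s n + \<tau>)) * y n)\<^sup>2)"
    by (rule Cauchy_Schwarz_ineq_sum)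
  also have "(\<Sum>n\<in>A. (sqrt ((s n)\<^sup>2 + \<tau> * s n))\<^sup>2) = (\<Sum>n\<in>A. (s n)\<^sup>2 + \<tau> * s n)"
    using assms by (intro sum.cong) (auto simp: less_imp_le)
  also have "(\<Sum>n\<in>A. (sqrt (s n / (s n + \<tau>)) * y n)\<^sup>2) = (\<Sum>n\<in>A. s n / (s n + \<tau>) * (y n)\<^sup>2)"
    using assms by (intro sum.cong) (auto simp: power_mult_distrib less_imp_le add_pos_pos)
  finally show ?thesis .
qed

section \<open>Random series with independent Gaussian coefficients\<close>

locale gaussian_series = prob_space M
  for M :: "'w measure" +
  fixes I :: "'i set" and g :: "'i \<Rightarrow> 'w \<Rightarrow> complex" and s :: "'i \<Rightarrow> real"
    and f :: "'i \<Rightarrow> 'x::second_countable_topology \<Rightarrow> complex"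
  assumes I: "countable I" "I \<noteq> {}"
    and indep: "indep_vars (\<lambda>_. borel) g I"
    and gaussian: "\<And>n. n \<in> I \<Longrightarrow> std_complex_gaussian M (g n)"
    and s_pos: "\<And>n. n \<in> I \<Longrightarrow> s n > 0"
    and s_summable: "s summable_on I"
    and norm_f: "\<And>n x. n \<in> I \<Longrightarrow> cmod (f n x) = s n"
    and cont_f: "\<And>n. n \<in> I \<Longrightarrow> continuous_on UNIV (f n)"
begin

definition series :: "'w \<Rightarrow> 'x \<Rightarrow> complex" where
  "series w x = (\<Sum>\<^sub>\<infinity>n\<in>I. f n x * g n w)"

definition variance_sum :: real where
  "variance_sum = (\<Sum>\<^sub>\<infinity>n\<in>I. (s n)\<^sup>2)"

definition weight :: "real \<Rightarrow> 'i \<Rightarrow> real" where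
  "weight \<tau> n = s n / (s n + \<tau>)"

definition energy :: "real \<Rightarrow> 'i set \<Rightarrow> 'w \<Rightarrow> real" where
  "energy \<tau> A w = (\<Sum>n\<in>A. weight \<tau> n * (cmod (g n w))\<^sup>2)"

text \<open>Partial energies stand in for the infinite sum, so that outcomes of divergent energy
  belong to the event along an exhaustion; a divergent infinite sum would count as 0.\<close>

definition energy_event :: "real \<Rightarrow> (nat \<Rightarrow> 'i set) \<Rightarrow> real \<Rightarrow> 'w set" where
  "energy_event \<tau> A r = {w \<in> space M. \<exists>N. energy \<tau> (A N) w \<ge> r}"

text \<open>The first Cauchy-Schwarz factor, extended to all of \<open>I\<close>; it tends to
  \<open>variance_sum\<close> as \<tau> tends to 0.\<close>

definition energy_bound :: "real \<Rightarrow> real" where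
  "energy_bound \<tau> = variance_sum + \<tau> * (\<Sum>\<^sub>\<infinity>n\<in>I. s n)"

lemma g_measurable [measurable]: "n \<in> I \<Longrightarrow> g n \<in> borel_measurable M"
  using indep by (auto simp: indep_vars_def)

lemma weight_bounds:
  assumes "n \<in> I" "\<tau> > 0"
  shows "weight \<tau> n > 0" "weight \<tau> n < 1" "weight \<tau> n \<le> s n / \<tau>"
  using s_pos[OF assms(1)] assms(2) by (auto simp: weight_def divide_simps algebra_simps)

lemma weight_summable:
  assumes "\<tau> > 0"
  shows "weight \<tau> summable_on I"
proof (rule summable_on_comparison_test)
  show "(\<lambda>n. s n / \<tau>) summable_on I"
    using summable_on_cmult_right[OF s_summable, of "1 / \<tau>"] by simp
qed (use weight_bounds[OF _ assms] in \<open>auto simp: less_imp_le\<close>)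

lemma s_square_summable: "(\<lambda>n. (s n)\<^sup>2) summable_on I"
proof -
  have "(\<lambda>n. s n * (\<Sum>\<^sub>\<infinity>m\<in>I. s m)) summable_on I"
    using s_summable by (rule summable_on_cmult_left)
  moreover have "(s n)\<^sup>2 \<le> s n * (\<Sum>\<^sub>\<infinity>m\<in>I. s m)" if "n \<in> I" for n
  proof -
    have "s n \<le> (\<Sum>\<^sub>\<infinity>m\<in>I. s m)"
      using finite_sum_le_infsum[OF s_summable, of "{n}"] that s_pos by (auto simp: less_imp_le)
    then show ?thesis using s_pos[OF that] by (simp add: power2_eq_square)
  qed
  ultimately show ?thesis
    by (rule summable_on_comparison_test) simp_all
qed

lemma variance_sum_pos: "variance_sum > 0"
proof -
  obtain n where n: "n \<in> I" using I by auto
  have "(s n)\<^sup>2 \<le> variance_sum"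
    unfolding variance_sum_def
    using finite_sum_le_infsum[OF s_square_summable, of "{n}"] n by auto
  moreover have "(s n)\<^sup>2 > 0" using s_pos[OF n] by simp
  ultimately show ?thesis by linarith
qed

lemma energy_bound_pos: "\<tau> > 0 \<Longrightarrow> energy_bound \<tau> > 0"
  unfolding energy_bound_def using variance_sum_pos s_pos
  by (intro add_pos_nonneg mult_nonneg_nonneg infsum_nonneg) (auto simp: less_imp_le)

lemma sum_le_energy_bound:
  assumes "finite A" "A \<subseteq> I" "\<tau> > 0"
  shows "(\<Sum>n\<in>A. (s n)\<^sup>2 + \<tau> * s n) \<le> energy_bound \<tau>"
proof -
  have "(\<Sum>n\<in>A. (s n)\<^sup>2) \<le> variance_sum"
    unfolding variance_sum_def by (intro finite_sum_le_infsum s_square_summable assms) auto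
  moreover have "(\<Sum>n\<in>A. s n) \<le> (\<Sum>\<^sub>\<infinity>n\<in>I. s n)"
    using s_pos by (intro finite_sum_le_infsum s_summable assms) (auto simp: less_imp_le)
  ultimately show ?thesis
    using \<open>\<tau> > 0\<close> by (simp add: energy_bound_def sum.distrib flip: sum_distrib_left) (intro add_mono; simp)
qed

lemma energy_nonneg: "A \<subseteq> I \<Longrightarrow> \<tau> > 0 \<Longrightarrow> energy \<tau> A w \<ge> 0"
  unfolding energy_def using weight_bounds(1) by (intro sum_nonneg) (auto simp: less_imp_le)

lemma energy_mono: "finite A \<Longrightarrow> A \<subseteq> A' \<Longrightarrow> finite A' \<Longrightarrow> A' \<subseteq> I \<Longrightarrow> \<tau> > 0 \<Longrightarrow>
    energy \<tau> A w \<le> energy \<tau> A' w"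
  unfolding energy_def using weight_bounds(1)
  by (intro sum_mono2) (auto simp: less_imp_le subset_iff)

lemma square_sum_le_energy_bound_mult_energy:
  assumes "finite A" "A \<subseteq> I" "\<tau> > 0"
  shows "(\<Sum>n\<in>A. s n * cmod (g n w))\<^sup>2 \<le> energy_bound \<tau> * energy \<tau> A w"
proof -
  have "(\<Sum>n\<in>A. s n * cmod (g n w))\<^sup>2 \<le> (\<Sum>n\<in>A. (s n)\<^sup>2 + \<tau> * s n) * energy \<tau> A w"
    unfolding energy_def weight_def using assms s_pos
    by (intro weighted_Cauchy_Schwarz) auto
  also have "\<dots> \<le> energy_bound \<tau> * energy \<tau> A w"
    using assms by (intro mult_right_mono sum_le_energy_bound energy_nonneg)
  finally show ?thesis .
qed

section \<open>Chernoff bound for the energy and upper bound for the series\<close>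

lemma energy_measurable [measurable]: "A \<subseteq> I \<Longrightarrow> energy \<tau> A \<in> borel_measurable M"
  unfolding energy_def by (intro borel_measurable_sum) (auto intro!: borel_measurable_times)

text \<open>By independence the exponential moment of order \<open>a\<close> is a product of
  explicit factors. What matters is that the bound on this product is the same for every finite
  \<open>A\<close>.\<close>

lemma energy_tail:
  assumes A: "finite A" "A \<subseteq> I" and \<tau>: "\<tau> > 0" and a: "0 < a" "a < 1"
  shows "prob {w \<in> space M. energy \<tau> A w \<ge> r}
    \<le> exp (a / (1 - a) * (\<Sum>\<^sub>\<infinity>n\<in>I. weight \<tau> n)) * exp (- a * r)"
proof -
  let ?E = "\<lambda>n w. ennreal (exp (a * weight \<tau> n * (cmod (g n w))\<^sup>2))"
  have ind: "indep_vars (\<lambda>_. borel) ?E A"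
    using indep_vars_subset[OF indep A(2)]
    by (rule indep_vars_compose2[where Y = "\<lambda>n y. ennreal (exp (a * weight \<tau> n * (cmod y)\<^sup>2))"]) simp
  \<comment> \<open>An exponential bound turns the product over \<open>n\<close> into a sum of
    weights, which is summable; \<open>weight \<tau> n < 1\<close> keeps the denominator above
    \<open>1 - a\<close>.\<close>
  have factor: "1 / (1 - a * weight \<tau> n) \<le> exp (a / (1 - a) * weight \<tau> n)" if "n \<in> I" for n
  proof -
    have v: "0 < weight \<tau> n" "weight \<tau> n < 1" using weight_bounds[OF that \<tau>] by auto
    have pos: "1 - a * weight \<tau> n \<ge> 1 - a" 
      using a v by (simp add: mult_left_le)
    have pos': "1 - a * weight \<tau> n > 0" by (rule less_le_trans[OF _ pos]) (use a in simp)
    then have "1 / (1 - a * weight \<tau> n) = 1 + a * weight \<tau> n / (1 - a * weight \<tau> n)"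
      by (simp add: field_simps)
    also have "\<dots> \<le> 1 + a * weight \<tau> n / (1 - a)"
      using pos pos' a v by (intro add_left_mono divide_left_mono mult_pos_pos) simp_all
    also have "\<dots> \<le> exp (a * weight \<tau> n / (1 - a))" by (rule exp_ge_add_one_self)
    finally show ?thesis by simp
  qed
  have "ennreal (prob {w \<in> space M. energy \<tau> A w \<ge> r}) = emeasure M {w \<in> space M. energy \<tau> A w \<ge> r}"
    by (simp add: emeasure_eq_measure)
  also have "\<dots> \<le> ennreal (exp (- a * r)) *
      (\<integral>\<^sup>+w. ennreal (exp (a * energy \<tau> A w)) * indicator (space M) w \<partial>M)"
    using a A by (intro Chernoff_ineq_nn_integral_ge) auto
  also have "(\<integral>\<^sup>+w. ennreal (exp (a * energy \<tau> A w)) * indicator (space M) w \<partial>M) =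
      (\<integral>\<^sup>+w. (\<Prod>n\<in>A. ?E n w) \<partial>M)"
    using A(1) by (intro nn_integral_cong)
      (simp add: energy_def sum_distrib_left exp_sum prod_ennreal mult.assoc)
  also have "\<dots> = (\<Prod>n\<in>A. \<integral>\<^sup>+w. ?E n w \<partial>M)"
    using A(1) ind by (rule indep_vars_nn_integral) simp
  also have "\<dots> = (\<Prod>n\<in>A. ennreal (1 / (1 - a * weight \<tau> n)))"
  proof (intro prod.cong refl nn_integral_exp_std_complex_gaussian)
    fix n assume "n \<in> A"
    then have n: "n \<in> I" using A by auto
    show "std_complex_gaussian M (g n)" by (rule gaussian[OF n])
    show "a * weight \<tau> n < 1"
      using weight_bounds[OF n \<tau>] a mult_strict_mono[of a 1 "weight \<tau> n" 1] by auto
  qed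
  also have "\<dots> \<le> (\<Prod>n\<in>A. ennreal (exp (a / (1 - a) * weight \<tau> n)))"
    using A factor by (intro prod_mono_ennreal ennreal_leI) auto
  also have "\<dots> = ennreal (exp (a / (1 - a) * (\<Sum>n\<in>A. weight \<tau> n)))"
    using A(1) by (simp add: prod_ennreal exp_sum sum_distrib_left)
  also have "\<dots> \<le> ennreal (exp (a / (1 - a) * (\<Sum>\<^sub>\<infinity>n\<in>I. weight \<tau> n)))"
  proof (intro ennreal_leI)
    have "(\<Sum>n\<in>A. weight \<tau> n) \<le> (\<Sum>\<^sub>\<infinity>n\<in>I. weight \<tau> n)"
      using weight_bounds(1)[OF _ \<tau>] by (intro finite_sum_le_infsum weight_summable[OF \<tau>] A) (auto simp: less_imp_le)
    then show "exp (a / (1 - a) * (\<Sum>n\<in>A. weight \<tau> n)) \<le> exp (a / (1 - a) * (\<Sum>\<^sub>\<infinity>n\<in>I. weight \<tau> n))"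
      using a by (simp add: mult_left_mono divide_right_mono)
  qed
  finally have "ennreal (prob {w \<in> space M. energy \<tau> A w \<ge> r})
    \<le> ennreal (exp (- a * r)) * ennreal (exp (a / (1 - a) * (\<Sum>\<^sub>\<infinity>n\<in>I. weight \<tau> n)))"
    by (simp add: mult_left_mono)
  then show ?thesis
    by (subst (asm) ennreal_mult[symmetric]) (auto simp: mult.commute)
qed

text \<open>The events for the single \<open>N\<close> increase, so the bound uniform in
  \<open>N\<close> passes to their union by continuity from below.\<close>

lemma energy_event_tail:
  assumes A: "incseq A" "\<And>N. finite (A N)" "\<And>N. A N \<subseteq> I" and \<tau>: "\<tau> > 0" and a: "0 < a" "a < 1"
  shows "energy_event \<tau> A r \<in> sets M"
    and "prob (energy_event \<tau> A r) \<le> exp (a / (1 - a) * (\<Sum>\<^sub>\<infinity>n\<in>I. weight \<tau> n)) * exp (- a * r)"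
proof -
  define E where "E N = {w \<in> space M. energy \<tau> (A N) w \<ge> r}" for N
  have E: "range E \<subseteq> sets M"
    using A(3) by (auto simp: E_def)
  have eq: "energy_event \<tau> A r = (\<Union>N. E N)"
    by (auto simp: energy_event_def E_def)
  show "energy_event \<tau> A r \<in> sets M"
    unfolding eq using E by auto
  have "incseq E"
  proof (intro incseq_SucI subsetI)
    fix N w assume "w \<in> E N"
    moreover have "energy \<tau> (A N) w \<le> energy \<tau> (A (Suc N)) w"
      using A \<tau> by (intro energy_mono) (auto simp: incseq_Suc_iff)
    ultimately show "w \<in> E (Suc N)" by (auto simp: E_def)
  qed
  from finite_Lim_measure_incseq[OF E this]
  have "(\<lambda>N. prob (E N)) \<longlonglongrightarrow> prob (energy_event \<tau> A r)" by (simp add: eq)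
  then show "prob (energy_event \<tau> A r) \<le> exp (a / (1 - a) * (\<Sum>\<^sub>\<infinity>n\<in>I. weight \<tau> n)) * exp (- a * r)"
    by (rule LIMSEQ_le_const2) (use energy_tail[OF A(2,3) \<tau> a] in \<open>auto simp: E_def\<close>)
qed

lemma partial_sums_tendsto_series:
  assumes "(\<lambda>n. f n x * g n w) summable_on I" "filterlim A (finite_subsets_at_top I) sequentially"
  shows "(\<lambda>N. \<Sum>n\<in>A N. f n x * g n w) \<longlonglongrightarrow> series w x"
  using has_sum_infsum[OF assms(1)] assms(2) unfolding has_sum_def series_def
  by (rule filterlim_compose)

lemma norm_sum_le_energy_bound_mult_energy:
  assumes "finite A" "A \<subseteq> I" "\<tau> > 0"
  shows "(cmod (\<Sum>n\<in>A. f n x * g n w))\<^sup>2 \<le> energy_bound \<tau> * energy \<tau> A w"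
proof -
  have "cmod (\<Sum>n\<in>A. f n x * g n w) \<le> (\<Sum>n\<in>A. s n * cmod (g n w))"
    using assms(2) by (intro sum_norm_le) (auto simp: norm_mult norm_f)
  then have "(cmod (\<Sum>n\<in>A. f n x * g n w))\<^sup>2 \<le> (\<Sum>n\<in>A. s n * cmod (g n w))\<^sup>2"
    by (intro power_mono) auto
  also note square_sum_le_energy_bound_mult_energy[OF assms]
  finally show ?thesis .
qed

text \<open>A strict excess of the limit already occurs for some partial sum, and there
  Cauchy-Schwarz applies. The resulting event is free of \<open>x\<close>, so one event covers the
  whole supremum.\<close>

lemma large_series_energy_event:
  assumes A: "\<And>N. finite (A N)" "\<And>N. A N \<subseteq> I" "filterlim A (finite_subsets_at_top I) sequentially"
    and \<tau>: "\<tau> > 0" and l: "l \<ge> 0" and w: "w \<in> space M" "cmod (series w x) > l"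
  shows "w \<in> energy_event \<tau> A (l\<^sup>2 / energy_bound \<tau>)"
proof -
  \<comment> \<open>A divergent series has value 0 and cannot exceed \<open>l\<close>; a nonzero
    value therefore certifies convergence.\<close>
  have "series w x \<noteq> 0" using l w by auto
  then have "(\<lambda>n. f n x * g n w) summable_on I"
    unfolding series_def by (metis infsum_not_exists)
  then have "(\<lambda>N. cmod (\<Sum>n\<in>A N. f n x * g n w)) \<longlonglongrightarrow> cmod (series w x)"
    by (intro tendsto_norm partial_sums_tendsto_series A)
  then have "\<forall>\<^sub>F N in sequentially. cmod (\<Sum>n\<in>A N. f n x * g n w) > l"
    using w(2) by (rule order_tendstoD(1))
  then obtain N where "cmod (\<Sum>n\<in>A N. f n x * g n w) > l"
    by (auto simp: eventually_sequentially)
  then have "l\<^sup>2 \<le> (cmod (\<Sum>n\<in>A N. f n x * g n w))\<^sup>2"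
    using l by (intro power_mono) auto
  also have "\<dots> \<le> energy_bound \<tau> * energy \<tau> (A N) w"
    by (rule norm_sum_le_energy_bound_mult_energy[OF A(1,2) \<tau>])
  finally have "l\<^sup>2 / energy_bound \<tau> \<le> energy \<tau> (A N) w"
    using energy_bound_pos[OF \<tau>] by (simp add: field_simps)
  with w(1) show ?thesis by (auto simp: energy_event_def)
qed

lemma prob_large_series_le:
  assumes \<tau>: "\<tau> > 0" and a: "0 < a" "a < 1" and l: "l \<ge> 0"
  shows "prob {w \<in> space M. \<exists>x. cmod (series w x) > l}
    \<le> exp (a / (1 - a) * (\<Sum>\<^sub>\<infinity>n\<in>I. weight \<tau> n)) * exp (- a * (l\<^sup>2 / energy_bound \<tau>))"
proof -
  obtain A :: "nat \<Rightarrow> 'i set" where A: "incseq A" "\<And>N. finite (A N)" "\<And>N. A N \<subseteq> I"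
      "filterlim A (finite_subsets_at_top I) sequentially"
    using exhausting_finite_subsets[OF I] by metis
  have "prob {w \<in> space M. \<exists>x. cmod (series w x) > l} \<le> prob (energy_event \<tau> A (l\<^sup>2 / energy_bound \<tau>))"
    using large_series_energy_event[OF A(2-4) \<tau> l]
    by (intro finite_measure_mono energy_event_tail(1)[OF A(1-3) \<tau> a]) auto
  also note energy_event_tail(2)[OF A(1-3) \<tau> a]
  finally show ?thesis .
qed

section \<open>Almost sure convergence and measurability\<close>

lemma AE_summable: "AE w in M. \<forall>x. (\<lambda>n. f n x * g n w) summable_on I"
proof -
  obtain A :: "nat \<Rightarrow> 'i set" where A: "incseq A" "\<And>N. finite (A N)" "\<And>N. A N \<subseteq> I"
      "filterlim A (finite_subsets_at_top I) sequentially"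
    using exhausting_finite_subsets[OF I] by metis
  \<comment> \<open>These are the outcomes with unbounded partial energies. The tail bound is used
    with \<open>\<tau> = 1\<close> and \<open>a = 1/2\<close>, for which \<open>a / (1 - a)\<close>
    is 1.\<close>
  define Z where "Z = (\<Inter>k. energy_event 1 A (real k))"
  have tail: "energy_event 1 A (real k) \<in> sets M"
      "prob (energy_event 1 A (real k)) \<le> exp (\<Sum>\<^sub>\<infinity>n\<in>I. weight 1 n) * exp (- (1/2) * real k)" for k
    using energy_event_tail[OF A(1-3), of 1 "1/2" "real k"] by simp_all
  have Z: "Z \<in> sets M" unfolding Z_def using tail(1) by auto
  have "prob Z \<le> exp (\<Sum>\<^sub>\<infinity>n\<in>I. weight 1 n) * exp (- (1/2) * real k)" for k
  proof -
    have "prob Z \<le> prob (energy_event 1 A (real k))"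
      by (intro finite_measure_mono tail) (auto simp: Z_def)
    then show ?thesis using tail(2)[of k] by linarith
  qed
  then have le: "\<exists>N. \<forall>k\<ge>N. prob Z \<le> exp (\<Sum>\<^sub>\<infinity>n\<in>I. weight 1 n) * exp (- (1/2) * real k)"
    by blast
  have lim: "(\<lambda>k. exp (\<Sum>\<^sub>\<infinity>n\<in>I. weight 1 n) * exp (- (1/2) * real k)) \<longlonglongrightarrow> exp (\<Sum>\<^sub>\<infinity>n\<in>I. weight 1 n) * 0"
    by (intro tendsto_mult_left filterlim_compose[OF exp_at_bot]
        filterlim_tendsto_neg_mult_at_bot[OF tendsto_const] filterlim_real_sequentially) simp
  have "prob Z \<le> exp (\<Sum>\<^sub>\<infinity>n\<in>I. weight 1 n) * 0"
    by (rule LIMSEQ_le_const[OF lim le])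
  then have "emeasure M Z = 0"
    using measure_nonneg[of M Z] by (simp add: emeasure_eq_measure)
  moreover have "{w \<in> space M. \<not> (\<forall>x. (\<lambda>n. f n x * g n w) summable_on I)} \<subseteq> Z"
  proof (rule subsetI, rule ccontr)
    fix w assume w: "w \<in> {w \<in> space M. \<not> (\<forall>x. (\<lambda>n. f n x * g n w) summable_on I)}" and "w \<notin> Z"
    then obtain k where k: "\<And>N. energy 1 (A N) w \<le> real k"
      by (auto simp: Z_def energy_event_def not_le intro: less_imp_le)
    \<comment> \<open>Bounded energy bounds all finite sums of norms by Cauchy-Schwarz. These norms
      do not involve \<open>x\<close>, so one null set serves all \<open>x\<close>.\<close>
    have "(\<lambda>n. s n * cmod (g n w)) summable_on I"
    proof (rule nonneg_bdd_above_summable_on)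
      show "s n * cmod (g n w) \<ge> 0" if "n \<in> I" for n using s_pos[OF that] by simp
      show "bdd_above (sum (\<lambda>n. s n * cmod (g n w)) ` {F. F \<subseteq> I \<and> finite F})"
      proof (rule bdd_aboveI2)
        fix F assume F: "F \<in> {F. F \<subseteq> I \<and> finite F}"
        then obtain N where N: "F \<subseteq> A N"
          using A(4) by (fastforce simp: filterlim_finite_subsets_at_top eventually_sequentially)
        have "(\<Sum>n\<in>F. s n * cmod (g n w))\<^sup>2 \<le> energy_bound 1 * energy 1 F w"
          using F by (intro square_sum_le_energy_bound_mult_energy) auto
        also have "\<dots> \<le> energy_bound 1 * real k"
          using energy_mono[OF _ N A(2,3), of 1 w] F k[of N] energy_bound_pos[of 1] by (intro mult_left_mono) auto
        finally show "(\<Sum>n\<in>F. s n * cmod (g n w)) \<le> sqrt (energy_bound 1 * real k)"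
          by (rule real_le_rsqrt)
      qed
    qed
    then have "(\<lambda>n. cmod (f n x * g n w)) summable_on I" for x
      by (rule summable_on_cong[THEN iffD1, rotated]) (simp add: norm_mult norm_f)
    with w show False
      by (simp add: summable_on_iff_abs_summable_on_complex)
  qed
  ultimately show ?thesis using Z by (intro AE_I) auto
qed

lemma series_measurable [measurable]: "(\<lambda>w. series w x) \<in> borel_measurable M"
  unfolding series_def using I by (intro borel_measurable_infsum_complex) auto

text \<open>The \<open>\<exists>x\<close> ranges over an uncountable set; continuity in \<open>x\<close> reduces it to a countable dense one.
  Where the series diverges \<open>\<Sum>\<^sub>\<infinity>\<close> is \<open>0\<close> for every \<open>x\<close>, so continuity holds on all of \<open>space M\<close>.\<close>

lemma large_series_measurable: "{w \<in> space M. \<exists>x. cmod (series w x) > l} \<in> sets M"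
proof -
  obtain D :: "'x set" where D: "countable D" "\<And>X. open X \<Longrightarrow> X \<noteq> {} \<Longrightarrow> \<exists>d\<in>D. d \<in> X"
    using countable_dense_exists by metis
  have cont: "continuous_on UNIV (\<lambda>x. cmod (series w x))" for w
    unfolding series_def using cont_f
    by (intro continuous_on_norm continuous_on_infsum_complex[where b = "\<lambda>n. s n * cmod (g n w)"]
        continuous_on_mult_right) (auto simp: norm_mult norm_f)
  have "(\<exists>x. cmod (series w x) > l) \<longleftrightarrow> (\<exists>x\<in>D. cmod (series w x) > l)" for w
    using D(2)[of "{x. cmod (series w x) > l}"] open_Collect_less[OF continuous_on_const cont[of w], of l]
    by blast
  moreover have "{w \<in> space M. \<exists>x\<in>D. cmod (series w x) > l} \<in> sets M"
    using D(1) by measurable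
  ultimately show ?thesis by simp
qed

section \<open>Lower bound from the real part at a single point\<close>

lemma prob_large_series_ge:
  assumes l: "l \<ge> 0"
  shows "prob {w \<in> space M. \<exists>x. cmod (series w x) > l} \<ge> normal_density 0 (sqrt (variance_sum / 2)) (l + 2)"
proof -
  obtain A :: "nat \<Rightarrow> 'i set" where A: "incseq A" "\<And>N. finite (A N)" "\<And>N. A N \<noteq> {}" "\<And>N. A N \<subseteq> I"
      "filterlim A (finite_subsets_at_top I) sequentially"
    using exhausting_finite_subsets[OF I] by metis
  obtain x :: 'x where True by blast
  define S where "S N w = (\<Sum>n\<in>A N. Re (f n x * g n w))" for N w
  have S_measurable [measurable]: "S N \<in> borel_measurable M" for N
    unfolding S_def using A(4)[of N] by (intro borel_measurable_sum) auto
  define \<sigma> where "\<sigma> N = sqrt ((\<Sum>n\<in>A N. (s n)\<^sup>2) / 2)" for N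
  have \<sigma>_pos: "\<sigma> N > 0" for N
    unfolding \<sigma>_def using A s_pos by (auto intro!: sum_pos) (metis order_less_irrefl subsetD)
  have normal: "distributed M lborel (S N) (normal_density 0 (\<sigma> N))" for N
  proof -
    have "indep_vars (\<lambda>_. borel) (\<lambda>n w. Re (f n x * g n w)) (A N)"
      using indep_vars_subset[OF indep A(4)]
      by (rule indep_vars_compose2[where Y = "\<lambda>n y. Re (f n x * y)"]) simp
    then have "distributed M lborel (S N) (normal_density (\<Sum>n\<in>A N. 0) (sqrt (\<Sum>n\<in>A N. (s n / sqrt 2)\<^sup>2)))"
      unfolding S_def using A(2,3)
    proof (intro sum_indep_normal)
      fix n assume "n \<in> A N"
      then have n: "n \<in> I" using A(4) by auto
      then show "0 < s n / sqrt 2" using s_pos by simp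
      have "f n x \<noteq> 0" using norm_f[OF n, of x] s_pos[OF n] by auto
      from Re_mult_std_complex_gaussian[OF gaussian[OF n] this]
      show "distributed M lborel (\<lambda>w. Re (f n x * g n w)) (normal_density 0 (s n / sqrt 2))"
        by (simp only: norm_f[OF n])
    qed
    then show ?thesis
      by (simp add: \<sigma>_def power_divide sum_divide_distrib)
  qed
  \<comment> \<open>Two units of slack: one separates a limit of real part at most \<open>l\<close>
    from the level \<open>l + 1\<close>, the other is spent in
    \<open>prob_ge_normal_density\<close>.\<close>
  define p where "p N = normal_density 0 (\<sigma> N) (l + 2)" for N
  \<comment> \<open>The \<open>G N\<close> increase to the event that the partial sums are
    eventually below \<open>l + 1\<close>, which almost surely contains the event that the series
    has modulus at most \<open>l\<close>. Bounds for finite sums thus pass to the limit through the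
    variances alone.\<close>
  define G where "G N = {w \<in> space M. \<forall>m\<ge>N. S m w < l + 1}" for N
  have G: "range G \<subseteq> sets M" by (auto simp: G_def)
  have prob_G: "prob (G N) \<le> 1 - p N" for N
  proof -
    have "p N \<le> prob {w \<in> space M. l + 1 \<le> S N w}"
      using prob_ge_normal_density[OF normal \<sigma>_pos, of "l + 1" N] l by (simp add: p_def add.commute)
    also have "\<dots> = 1 - prob {w \<in> space M. \<not> l + 1 \<le> S N w}"
      by (subst prob_neg) auto
    finally have "prob {w \<in> space M. \<not> l + 1 \<le> S N w} \<le> 1 - p N" by simp
    moreover have "prob (G N) \<le> prob {w \<in> space M. \<not> l + 1 \<le> S N w}"
      by (intro finite_measure_mono) (auto simp: G_def)
    ultimately show ?thesis by simp
  qed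
  have "(\<lambda>N. \<Sum>n\<in>A N. (s n)\<^sup>2) \<longlonglongrightarrow> variance_sum"
    using has_sum_infsum[OF s_square_summable] A(5) unfolding has_sum_def variance_sum_def
    by (rule filterlim_compose)
  then have "p \<longlonglongrightarrow> normal_density 0 (sqrt (variance_sum / 2)) (l + 2)"
    unfolding p_def \<sigma>_def normal_density_def using variance_sum_pos
    by (intro tendsto_intros) auto
  moreover have "(\<lambda>N. prob (G N)) \<longlonglongrightarrow> prob (\<Union>N. G N)"
    by (rule finite_Lim_measure_incseq[OF G]) (auto simp: G_def incseq_def)
  ultimately have "prob (\<Union>N. G N) \<le> 1 - normal_density 0 (sqrt (variance_sum / 2)) (l + 2)"
    using prob_G by (intro LIMSEQ_le[OF _ tendsto_diff[OF tendsto_const]]) auto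
  moreover have "prob {w \<in> space M. cmod (series w x) \<le> l} \<le> prob (\<Union>N. G N)"
  proof (rule finite_measure_mono_AE)
    show "AE w in M. w \<in> {w \<in> space M. cmod (series w x) \<le> l} \<longrightarrow> w \<in> (\<Union>N. G N)"
      using AE_summable
    proof eventually_elim
      case (elim w)
      show ?case
      proof
        assume w: "w \<in> {w \<in> space M. cmod (series w x) \<le> l}"
        have "(\<lambda>N. Re (\<Sum>n\<in>A N. f n x * g n w)) \<longlonglongrightarrow> Re (series w x)"
          using elim by (intro tendsto_Re partial_sums_tendsto_series A) auto
        moreover have "Re (series w x) < l + 1"
          using w complex_Re_le_cmod[of "series w x"] by auto
        ultimately have "\<forall>\<^sub>F N in sequentially. S N w < l + 1"
          unfolding S_def Re_sum[symmetric] by (rule order_tendstoD(2))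
        with w show "w \<in> (\<Union>N. G N)"
          by (auto simp: G_def eventually_sequentially)
      qed
    qed
    show "(\<Union>N. G N) \<in> sets M" using G by auto
  qed
  moreover have "prob {w \<in> space M. \<not> cmod (series w x) \<le> l} = 1 - prob {w \<in> space M. cmod (series w x) \<le> l}"
    by (rule prob_neg) auto
  moreover have "prob {w \<in> space M. \<not> cmod (series w x) \<le> l} \<le> prob {w \<in> space M. \<exists>x. cmod (series w x) > l}"
    by (intro finite_measure_mono large_series_measurable) (auto simp: not_le)
  ultimately show ?thesis by simp
qed

section \<open>The logarithmic limit\<close>

lemma large_deviation:
  assumes z: "z > 0"
  shows "((\<lambda>\<epsilon>. \<epsilon> * ln (prob {w \<in> space M. \<exists>x. cmod (series w x) > z * \<epsilon> powr (- 1/2)}))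
    \<longlongrightarrow> - (z\<^sup>2 / variance_sum)) (at_right 0)"
proof (rule order_tendstoI)
  let ?L = "\<lambda>\<epsilon>. \<epsilon> * ln (prob {w \<in> space M. \<exists>x. cmod (series w x) > z * \<epsilon> powr (- 1/2)})"
  let ?P = "\<lambda>\<epsilon>. prob {w \<in> space M. \<exists>x. cmod (series w x) > z * \<epsilon> powr (- 1/2)}"
  let ?\<sigma> = "sqrt (variance_sum / 2)"
  have powr: "\<epsilon> powr - (1/2) = 1 / sqrt \<epsilon>" if "\<epsilon> > 0" for \<epsilon> :: real
    using that powr_minus[of \<epsilon> "1/2"] by (simp add: powr_half_sqrt inverse_eq_divide)
  have lower: "normal_density 0 ?\<sigma> (z / sqrt \<epsilon> + 2) \<le> ?P \<epsilon>" if "\<epsilon> > 0" for \<epsilon>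
    using prob_large_series_ge[of "z / sqrt \<epsilon>"] that z by (simp add: powr)
  \<comment> \<open>The upper estimate takes logarithms too, and monotonicity of \<open>ln\<close>
    requires a positive probability.\<close>
  have P_pos: "?P \<epsilon> > 0" if "\<epsilon> > 0" for \<epsilon>
    using lower[OF that] normal_density_pos[of ?\<sigma> 0 "z / sqrt \<epsilon> + 2"] variance_sum_pos by simp
  {
    fix y assume y: "y < - (z\<^sup>2 / variance_sum)"
    \<comment> \<open>The normalising factor of the normal density with variance
      \<open>variance_sum / 2\<close>; its logarithm is killed by the factor \<epsilon>.\<close>
    define C where "C = 1 / sqrt (pi * variance_sum)"
    have "C > 0" using variance_sum_pos by (simp add: C_def)
    have "continuous_on UNIV (\<lambda>\<epsilon>. \<epsilon> * ln C - (z + 2 * sqrt \<epsilon>)\<^sup>2 / variance_sum)"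
      unfolding divide_inverse by (intro continuous_intros)
    then have "(\<lambda>\<epsilon>. \<epsilon> * ln C - (z + 2 * sqrt \<epsilon>)\<^sup>2 / variance_sum) \<midarrow>0\<rightarrow> - (z\<^sup>2 / variance_sum)"
      by (auto simp: continuous_on_def dest: spec[of _ 0])
    then have "((\<lambda>\<epsilon>. \<epsilon> * ln C - (z + 2 * sqrt \<epsilon>)\<^sup>2 / variance_sum) \<longlongrightarrow> - (z\<^sup>2 / variance_sum)) (at_right 0)"
      by (rule filterlim_mono[OF _ order_refl at_le]) simp
    from order_tendstoD(1)[OF this y] eventually_at_right_less[of 0]
    show "\<forall>\<^sub>F \<epsilon> in at_right 0. y < ?L \<epsilon>"
    proof eventually_elim
      case (elim \<epsilon>)
      have "\<epsilon> * (z / sqrt \<epsilon> + 2)\<^sup>2 = (sqrt \<epsilon> * (z / sqrt \<epsilon> + 2))\<^sup>2"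
        using elim by (simp add: power_mult_distrib)
      also have "sqrt \<epsilon> * (z / sqrt \<epsilon> + 2) = z + 2 * sqrt \<epsilon>"
        using elim by (simp add: distrib_left)
      finally have "\<epsilon> * ln C - (z + 2 * sqrt \<epsilon>)\<^sup>2 / variance_sum =
          \<epsilon> * (ln C + - (z / sqrt \<epsilon> + 2)\<^sup>2 / variance_sum)"
        by (simp add: right_diff_distrib)
      also have "ln C + - (z / sqrt \<epsilon> + 2)\<^sup>2 / variance_sum = ln (C * exp (- (z / sqrt \<epsilon> + 2)\<^sup>2 / variance_sum))"
        using \<open>C > 0\<close> by (simp only: ln_mult_pos exp_gt_zero ln_exp)
      also have "C * exp (- (z / sqrt \<epsilon> + 2)\<^sup>2 / variance_sum) = normal_density 0 ?\<sigma> (z / sqrt \<epsilon> + 2)"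
        using variance_sum_pos by (simp add: normal_density_def C_def)
      also have "\<epsilon> * ln (normal_density 0 ?\<sigma> (z / sqrt \<epsilon> + 2)) \<le> ?L \<epsilon>"
        using lower[of \<epsilon>] elim variance_sum_pos
        by (intro mult_left_mono ln_mono normal_density_pos) auto
      finally show ?case using elim by linarith
    qed
  }
  {
    fix y assume y: "- (z\<^sup>2 / variance_sum) < y"
    have "((\<lambda>\<tau>. - ((1 - \<tau>) * (z\<^sup>2 / energy_bound \<tau>))) \<longlongrightarrow> - ((1 - 0) * (z\<^sup>2 / (variance_sum + 0 * (\<Sum>\<^sub>\<infinity>n\<in>I. s n))))) (at_right 0)"
      unfolding energy_bound_def using variance_sum_pos by (intro tendsto_intros) auto
    from order_tendstoD(2)[OF this, of y] y
    have "\<forall>\<^sub>F \<tau> in at_right 0. - ((1 - \<tau>) * (z\<^sup>2 / energy_bound \<tau>)) < y" by simp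
    then have "\<forall>\<^sub>F \<tau> in at_right 0. - ((1 - \<tau>) * (z\<^sup>2 / energy_bound \<tau>)) < y \<and> 0 < \<tau> \<and> \<tau> < 1"
      using eventually_at_right_real[of 0 1] by (auto elim: eventually_elim2)
    then obtain \<tau> where \<tau>: "- ((1 - \<tau>) * (z\<^sup>2 / energy_bound \<tau>)) < y" "0 < \<tau>" "\<tau> < 1"
      using eventually_happens'[OF trivial_limit_at_right_real] by blast
    \<comment> \<open>A single parameter drives both approximations, of the order \<open>a\<close>
      to 1 and of \<open>energy_bound \<tau>\<close> to \<open>variance_sum\<close>. It is fixed
      before \<epsilon> tends to 0, so \<open>K\<close> is a constant and
      \<open>\<epsilon> * K\<close> vanishes in the limit.\<close>
    define a where "a = 1 - \<tau>"
    define K where "K = a / (1 - a) * (\<Sum>\<^sub>\<infinity>n\<in>I. weight \<tau> n)"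
    have a: "0 < a" "a < 1" using \<tau> by (auto simp: a_def)
    have "((\<lambda>\<epsilon>. \<epsilon> * K - a * (z\<^sup>2 / energy_bound \<tau>)) \<longlongrightarrow> 0 * K - a * (z\<^sup>2 / energy_bound \<tau>)) (at_right 0)"
      by (intro tendsto_intros)
    then have "\<forall>\<^sub>F \<epsilon> in at_right 0. \<epsilon> * K - a * (z\<^sup>2 / energy_bound \<tau>) < y"
      by (rule order_tendstoD(2)) (use \<tau>(1) in \<open>simp add: a_def\<close>)
    then show "\<forall>\<^sub>F \<epsilon> in at_right 0. ?L \<epsilon> < y"
      using eventually_at_right_less[of 0]
    proof eventually_elim
      case (elim \<epsilon>)
      have "?P \<epsilon> \<le> exp (K - a * (z\<^sup>2 / \<epsilon> / energy_bound \<tau>))"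
        using prob_large_series_le[OF \<tau>(2) a, of "z / sqrt \<epsilon>"] elim z
        by (simp add: powr K_def power_divide mult_exp_exp)
      then have "ln (?P \<epsilon>) \<le> ln (exp (K - a * (z\<^sup>2 / \<epsilon> / energy_bound \<tau>)))"
        using P_pos[of \<epsilon>] elim by (intro ln_mono) simp_all
      then have "ln (?P \<epsilon>) \<le> K - a * (z\<^sup>2 / \<epsilon> / energy_bound \<tau>)" by (simp only: ln_exp)
      then have "?L \<epsilon> \<le> \<epsilon> * (K - a * (z\<^sup>2 / \<epsilon> / energy_bound \<tau>))"
        using elim by (intro mult_left_mono) auto
      also have "\<dots> = \<epsilon> * K - a * (z\<^sup>2 / energy_bound \<tau>)"
        using elim by (simp add: right_diff_distrib)
      finally show ?case using elim by linarith
    qed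
  }
qed

end

section \<open>Application to the linear Schroedinger flow\<close>

theorem theorem2p1:
  fixes \<nu> :: "'d::finite \<Rightarrow> nat"
    and \<omega> :: "'d \<Rightarrow> nat \<Rightarrow> real"
    and \<rho> :: "'d \<Rightarrow> nat \<Rightarrow> real"
    and c :: "('d \<Rightarrow> nat \<Rightarrow> int) \<Rightarrow> complex"
    and M :: "'w measure"
    and g :: "('d \<Rightarrow> nat \<Rightarrow> int) \<Rightarrow> 'w \<Rightarrow> complex"
    and z0 t :: real
  assumes "\<And>j. \<nu> j \<ge> 1"
    and "(\<Sum>j\<in>UNIV. \<nu> j) > CARD('d)"
    and "\<And>j. rationally_independent (\<nu> j) (\<omega> j)"
    and "\<exists>n\<in>freq_lattice \<nu>. c n \<noteq> 0"
    and "\<And>n. n \<in> freq_lattice \<nu> \<Longrightarrow>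
           cmod (c n) \<le> (\<Prod>j\<in>UNIV. \<Prod>k=1..\<nu> j. (1 + \<bar>real_of_int (n j k)\<bar>) powr (- \<rho> j k))"
    and "\<exists>\<kappa>. \<forall>j. \<forall>k\<in>{1..\<nu> j}. \<kappa> j k > 0 \<and> \<rho> j k - \<kappa> j k > (2::real)"
    and "prob_space M"
    and "prob_space.indep_vars M (\<lambda>_. borel) g (freq_lattice \<nu>)"
    and "\<And>n. n \<in> freq_lattice \<nu> \<Longrightarrow> std_complex_gaussian M (g n)"
    and "z0 > 0"
  shows "((\<lambda>\<epsilon>. \<epsilon> * ln (\<P>(w in M.
             (SUP x. ereal (cmod (u_linear \<nu> \<omega> c (\<lambda>n. g n w) t x))) > ereal (z0 * \<epsilon> powr (-1/2)))))
           \<longlongrightarrow> - (z0\<^sup>2 / (\<Sum>\<^sub>\<infinity>n\<in>freq_lattice \<nu>. (cmod (c n))\<^sup>2))) (at_right 0)"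
proof -
  \<comment> \<open>Discarding zero coefficients changes neither sum and makes every remaining term
    a nondegenerate Gaussian, as \<open>s_pos\<close> demands.\<close>
  define I where "I = {n \<in> freq_lattice \<nu>. c n \<noteq> 0}"
  \<comment> \<open>Both exponentials have modulus 1, so neither \<open>t\<close> nor
    \<open>x\<close> affects the norm of a term; hence the rate is the same at every time.\<close>
  define f where "f n x = c n * exp (- \<i> * of_real (t * Q_form \<nu> \<omega> n)) * exp (\<i> * of_real (theta \<nu> \<omega> n x))"
    for n and x :: "real ^ 'd"
  have exp_unit: "cmod (exp (- \<i> * of_real r)) = 1" "cmod (exp (\<i> * of_real r)) = 1" for r
    using norm_exp_i_times[of "- r"] norm_exp_i_times[of r] by simp_all
  obtain \<kappa> where \<kappa>: "\<And>j k. k \<in> {1..\<nu> j} \<Longrightarrow> \<kappa> j k > 0 \<and> \<rho> j k - \<kappa> j k > 2"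
    using assms(6) by blast
  have "\<rho> j k > 1" if "k \<in> {1..\<nu> j}" for j k
    using \<kappa>[OF that] by linarith
  then have "(\<lambda>n. \<Prod>j\<in>UNIV. \<Prod>k=1..\<nu> j. (1 + \<bar>real_of_int (n j k)\<bar>) powr (- \<rho> j k)) summable_on freq_lattice \<nu>"
    by (rule summable_on_freq_lattice_prod_powr)
  then have "(\<lambda>n. cmod (c n)) summable_on freq_lattice \<nu>"
    using assms(5) by (rule summable_on_comparison_test) simp_all
  then have summable: "(\<lambda>n. cmod (c n)) summable_on I"
    by (rule summable_on_subset) (auto simp: I_def)
  interpret prob_space M by fact
  interpret gaussian_series M I g "\<lambda>n. cmod (c n)" f
  proof
    show "countable I" unfolding I_def using countable_freq_lattice[of \<nu>] by (rule countable_subset[rotated]) auto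
    show "I \<noteq> {}" using assms(4) by (auto simp: I_def)
    show "indep_vars (\<lambda>_. borel) g I"
      using assms(8) by (rule indep_vars_subset) (auto simp: I_def)
    show "continuous_on UNIV (f n)" for n
      unfolding f_def theta_def by (intro continuous_intros)
    show "cmod (f n x) = cmod (c n)" for n x
      by (simp only: f_def norm_mult exp_unit mult_1_right)
  qed (use assms(9) summable in \<open>auto simp: I_def\<close>)
  have series: "u_linear \<nu> \<omega> c (\<lambda>n. g n w) t x = series w x" for w x
    unfolding u_linear_def series_def f_def
    by (rule infsum_cong_neutral) (auto simp: I_def)
  have var: "(\<Sum>\<^sub>\<infinity>n\<in>freq_lattice \<nu>. (cmod (c n))\<^sup>2) = variance_sum"
    unfolding variance_sum_def by (rule infsum_cong_neutral) (auto simp: I_def)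
  \<comment> \<open>A supremum lies strictly above a level exactly when some \<open>x\<close> does;
    in \<open>ereal\<close> this includes an infinite supremum.\<close>
  show ?thesis
    using large_deviation[OF assms(10)] by (simp add: series var less_SUP_iff)
qed

end
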